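(* Let $\phi>0$, $\lambda>0$, and let $T$ be a random variable with the $\mathrm{IWL}(\phi,\lambda)$ distribution. Then the Shannon entropy of $T$ is $$H_S(\phi,\lambda)=\log(\lambda+\phi)+\log\Gamma(\phi)+\frac{\phi(\lambda+\phi+1)}{\lambda+\phi}-(\phi+1)\left(\frac{1}{\lambda+\phi}+\psi(\phi)\right)-\frac{\lambda^{\phi+1}\,\Omega(\phi,\lambda)}{(\lambda+\phi)\Gamma(\phi)},$$ where $\Omega(\phi,\lambda)=\int_0^\infty (x+1)\log(x+1)\,x^{\phi-1}e^{-\lambda x}\,dx$.
   Context: For $\phi>0$, $\lambda>0$, the inverse weighted Lindley distribution $\mathrm{IWL}(\phi,\lambda)$ is the distribution on $(0,\infty)$ with probability density function $$f(t\mid\phi,\lambda)=\frac{\lambda^{\phi+1}}{(\phi+\lambda)\Gamma(\phi)}\,t^{-\phi-1}\left(1+\frac1t\right)e^{-\lambda/t},\qquad t>0,$$ where $\Gamma$ is the gamma function. Its Shannon entropy is $H_S(\phi,\lambda)=-\int_0^\infty \log\big(f(t\mid\phi,\lambda)\big)\,f(t\mid\phi,\lambda)\,dt$, with $\log$ the natural logarithm. $\psi(k)=\frac{d}{dk}\log\Gamma(k)=\Gamma'(k)/\Gamma(k)$ is the digamma function. *)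

theory Defs
  imports "HOL-Probability.Probability"
begin

definition iwl_density :: "real \<Rightarrow> real \<Rightarrow> real \<Rightarrow> real" where
  "iwl_density phi lam t =
     (if t > 0
      then lam powr (phi + 1) / ((phi + lam) * Gamma phi) * t powr (- phi - 1) * (1 + 1 / t) * exp (- lam / t)
      else 0)"

(* Lebesgue integrals; by library convention they are 0 when the integrand is not integrable,
   so integrability of both integrands has to be stated separately. *)

definition iwl_entropy :: "real \<Rightarrow> real \<Rightarrow> real" where
  "iwl_entropy phi lam =
     - (LINT t:{0<..}|lborel. ln (iwl_density phi lam t) * iwl_density phi lam t)"

definition iwl_Omega :: "real \<Rightarrow> real \<Rightarrow> real" where
  "iwl_Omega phi lam =
     (LINT x:{0<..}|lborel. (x + 1) * ln (x + 1) * x powr (phi - 1) * exp (- lam * x))"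

end

theory Submission
  imports Defs
begin

text \<open>Substituting \<open>t = 1 / x\<close> turns the entropy into the expectation of the elementary functions
  \<open>x\<close>, \<open>ln x\<close> and \<open>ln (x + 1)\<close> under a mixture of the Gamma densities of shapes \<open>phi\<close> and \<open>phi + 1\<close>.
  The expectation of \<open>x\<close> is a ratio of Gamma values, that of \<open>ln (x + 1)\<close> is \<open>iwl_Omega\<close> up to the
  normalising constant, and that of \<open>ln x\<close> comes from differentiating Euler's integral
  \<open>\<integral> x powr (a - 1) * exp (- l * x) = Gamma a / l powr a\<close> in \<open>a\<close> under the integral sign.\<close>

section \<open>Bounds for the logarithm and for difference quotients of powers\<close>

text \<open>Take \<open>1 + u \<le> exp u\<close> at \<open>u = - d * ln x\<close> and drop the
  constant 1. An arbitrarily small negative power thus controls the logarithm near 0.\<close>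

lemma ln_ge_minus_powr:
  fixes x d :: real
  assumes "x > 0" "d > 0"
  shows "ln x \<ge> - (x powr (-d) / d)"
proof -
  have "1 + (-d) * ln x \<le> exp ((-d) * ln x)" by (rule exp_ge_add_one_self)
  then have "- d * ln x \<le> x powr (-d)" using assms by (simp add: powr_def)
  then show ?thesis using assms by (simp add: field_simps)
qed

text \<open>By convexity of \<open>exp\<close> the quotient lies between \<open>ln x\<close> and
  \<open>ln x * x powr h\<close>. The resulting bound does not depend on \<open>h\<close>, so it can
  serve as a majorant in dominated convergence.\<close>

lemma powr_diff_quotient_bound:
  fixes x h d :: real
  assumes "x > 0" "d > 0" "0 < h" "h \<le> 1"
  shows "\<bar>(x powr h - 1) / h\<bar> \<le> x powr 2 + x powr (-d) / d"
proof -
  have "1 + h * ln x \<le> exp (h * ln x)" by (rule exp_ge_add_one_self)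
  also have "exp (h * ln x) = x powr h" using assms by (simp add: powr_def)
  finally have "h * ln x \<le> x powr h - 1" by simp
  then have "ln x \<le> (x powr h - 1) / h" using assms by (simp add: field_simps)
  then have lower: "- (x powr (-d) / d) \<le> (x powr h - 1) / h"
    using ln_ge_minus_powr[OF assms(1,2)] by linarith
  have upper: "(x powr h - 1) / h \<le> x powr 2"
  proof (cases "x \<le> 1")
    case True
    then have "x powr h \<le> 1" using assms by (simp add: powr_le1)
    then have "(x powr h - 1) / h \<le> 0" using assms by (simp add: divide_le_0_iff)
    then show ?thesis by (rule order_trans) simp
  next
    case False
    \<comment> \<open>The same tangent inequality at the opposite point; multiplying by
      \<open>x powr h\<close> turns it into an upper bound for \<open>x powr h - 1\<close>.\<close>
    have "1 + - (h * ln x) \<le> exp (- (h * ln x))" by (rule exp_ge_add_one_self)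
    also have "\<dots> = 1 / x powr h" using assms by (simp add: powr_def exp_minus field_simps)
    finally have "x powr h - 1 \<le> h * (ln x * x powr h)" using assms by (simp add: field_simps)
    then have "(x powr h - 1) / h \<le> ln x * x powr h" using assms by (simp add: field_simps)
    also have "\<dots> \<le> x * x powr 1"
    proof (intro mult_mono)
      show "ln x \<le> x" using ln_le_minus_one[of x] assms by linarith
      show "x powr h \<le> x powr 1" using False assms by (intro powr_mono) auto
    qed (use assms in auto)
    also have "\<dots> = x powr 2" using assms by (simp add: power2_eq_square)
    finally show ?thesis .
  qed
  show ?thesis using lower upper assms
    by (intro abs_leI) (smt (verit) powr_ge_zero divide_nonneg_pos)+
qed

section \<open>Euler's integral and its derivative in the shape parameter\<close>

lemma has_bochner_integral_Gamma:
  fixes a l :: real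
  assumes "a > 0" "l > 0"
  shows "has_bochner_integral lborel
    (\<lambda>x. indicator {0<..} x * (x powr (a - 1) * exp (- l * x))) (Gamma a / l powr a)"
proof -
  have "has_bochner_integral lborel
    (\<lambda>x. indicator {0..} x * x powr (a - 1) / exp x) (Gamma a)"
    using Gamma_conv_nn_integral_real[OF assms(1)] assms(1)
    by (intro has_bochner_integral_nn_integral) (auto simp: Gamma_real_nonneg)
  then have "has_bochner_integral lborel
    (\<lambda>x. indicator {0..} (0 + l * x) * (0 + l * x) powr (a - 1) / exp (0 + l * x))
    (Gamma a /\<^sub>R \<bar>l\<bar>)"
    using assms(2) by (subst (asm) lborel_has_bochner_integral_real_affine_iff[where c = l and t = 0]) auto
  \<comment> \<open>The factor \<open>l powr (1 - a)\<close> cancels the power of \<open>l\<close>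
    that the scaling leaves in \<open>(l * x) powr (a - 1)\<close>.\<close>
  then have "has_bochner_integral lborel
    (\<lambda>x. l powr (1 - a) * (indicator {0..} (l * x) * (l * x) powr (a - 1) / exp (l * x)))
    (l powr (1 - a) * (Gamma a / l))"
    using assms(2) by (intro has_bochner_integral_mult_right) (simp add: divide_inverse_commute)
  also have "l powr (1 - a) * (Gamma a / l) = Gamma a / l powr a"
    using assms(2) by (simp add: powr_diff)
  \<comment> \<open>The two indicators differ only at 0, where \<open>0 powr (a - 1) = 0\<close>
    makes both sides vanish.\<close>
  also have "(\<lambda>x. l powr (1 - a) * (indicator {0..} (l * x) * (l * x) powr (a - 1) / exp (l * x)))
    = (\<lambda>x. indicator {0<..} x * (x powr (a - 1) * exp (- l * x)))"
    using assms(2)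
    by (auto simp: fun_eq_iff indicator_def powr_mult zero_le_mult_iff exp_minus powr_diff field_simps)
  finally show ?thesis .
qed

lemma has_bochner_integral_Gamma_ln:
  fixes a l :: real
  assumes "a > 0" "l > 0"
  shows "has_bochner_integral lborel
    (\<lambda>x. indicator {0<..} x * (ln x * (x powr (a - 1) * exp (- l * x))))
    (Gamma a / l powr a * (Digamma a - ln l))"
proof -
  define k where "k = (\<lambda>b x :: real. indicator {0<..} x * (x powr (b - 1) * exp (- l * x)))"
  define G where "G = (\<lambda>b :: real. Gamma b / l powr b)"
  \<comment> \<open>\<open>Suc n\<close> keeps every step in (0, 1], the range that
    \<open>powr_diff_quotient_bound\<close> covers.\<close>
  define h where "h = (\<lambda>n :: nat. 1 / real (Suc n))"
  define s where "s = (\<lambda>n x. (k (a + h n) x - k a x) / h n)"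
  define w where "w = (\<lambda>x. k (a + 2) x + k (a / 2) x / (a / 2))"
  have k: "has_bochner_integral lborel (k b) (G b)" if "b > 0" for b
    unfolding k_def G_def using has_bochner_integral_Gamma[OF that assms(2)] .
  have h: "h n > 0" "h n \<le> 1" for n by (auto simp: h_def)
  have h0: "h \<longlonglongrightarrow> 0" unfolding h_def by (rule LIMSEQ_Suc[OF lim_1_over_n])
  have h_at: "filterlim h (at 0) sequentially"
    using h h0 by (auto simp: filterlim_at less_imp_neq[symmetric])
  have s: "has_bochner_integral lborel (s n) ((G (a + h n) - G a) / h n)" for n
    unfolding s_def using h[of n] assms
    by (intro has_bochner_integral_divide_zero has_bochner_integral_diff k) auto
  have w: "integrable lborel w"
    unfolding w_def using assms k[of "a+2"] k[of "a/2"]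
    by (intro Bochner_Integration.integrable_add integrable_divide_zero) (auto simp: has_bochner_integral_iff)
  have k_add: "k (a + c) x = x powr c * k a x" for c x
    by (auto simp: k_def indicator_def powr_add powr_diff)
  text \<open>The majorant \<open>w\<close> is \<open>powr_diff_quotient_bound\<close> with \<open>d = a / 2\<close>, small enough that
    \<open>x powr (a - 1 - d)\<close> stays integrable at 0.\<close>
  have bound: "norm (s n x) \<le> w x" for n x
  proof (cases "x > 0")
    case True
    have "s n x = (x powr h n - 1) / h n * k a x"
      unfolding s_def k_add by (simp add: field_simps)
    moreover have "\<bar>k a x\<bar> = k a x" by (simp add: k_def)
    ultimately have "norm (s n x) = \<bar>(x powr h n - 1) / h n\<bar> * k a x"
      unfolding real_norm_def by (simp only: abs_mult)
    also have "\<dots> \<le> (x powr 2 + x powr (-(a/2)) / (a/2)) * k a x"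
      using True assms h[of n]
      by (intro mult_right_mono powr_diff_quotient_bound) (auto simp: k_def)
    also have "\<dots> = w x"
      using k_add[of 2 x] k_add[of "-(a/2)" x] by (simp add: w_def algebra_simps)
    finally show ?thesis .
  qed (auto simp: s_def w_def k_def)
  have lim: "(\<lambda>n. s n x) \<longlonglongrightarrow> indicator {0<..} x * (ln x * (x powr (a - 1) * exp (- l * x)))" for x
  proof (cases "x > 0")
    case True
    have "((\<lambda>b. k b x) has_real_derivative ln x * k a x) (at a)"
      unfolding k_def using True by (auto intro!: derivative_eq_intros)
    then have "(\<lambda>n. s n x) \<longlonglongrightarrow> ln x * k a x"
      unfolding s_def DERIV_def by (rule filterlim_compose[OF _ h_at])
    with True show ?thesis by (simp add: k_def)
  qed (auto simp: s_def k_def)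
  have meas: "s n \<in> borel_measurable lborel" for n
    using s[of n] by (auto simp: has_bochner_integral_iff)
  have D: "integrable lborel (\<lambda>x. indicator {0<..} x * (ln x * (x powr (a - 1) * exp (- l * x))))"
    by (rule integrable_dominated_convergence[where s = s and w = w])
      (use w bound lim meas in auto)
  have "(\<lambda>n. integral\<^sup>L lborel (s n)) \<longlonglongrightarrow>
    (\<integral>x. indicator {0<..} x * (ln x * (x powr (a - 1) * exp (- l * x))) \<partial>lborel)"
    by (rule integral_dominated_convergence[where w = w])
      (use w bound lim meas in auto)
  \<comment> \<open>The integrals of \<open>s n\<close> are difference quotients of
    \<open>G\<close>, so they also converge to its derivative at \<open>a\<close>; uniqueness of
    limits then gives the value.\<close>
  moreover have "(G has_real_derivative Gamma a / l powr a * (Digamma a - ln l)) (at a)"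
    unfolding G_def using assms
    by (auto intro!: derivative_eq_intros simp: field_simps elim!: nonpos_Ints_cases)
  then have "(\<lambda>n. integral\<^sup>L lborel (s n)) \<longlonglongrightarrow> Gamma a / l powr a * (Digamma a - ln l)"
    unfolding DERIV_def has_bochner_integral_integral_eq[OF s]
    by (rule filterlim_compose[OF _ h_at])
  ultimately show ?thesis
    using D LIMSEQ_unique by (auto simp: has_bochner_integral_iff)
qed

section \<open>The substitution \<open>t = 1 / x\<close>\<close>

text \<open>The map \<open>1 / x\<close> is a bijection of \<open>{0<..}\<close> onto itself whose
  derivative has absolute value \<open>1 / x\<^sup>2\<close>.\<close>

lemma has_bochner_integral_inversion:
  fixes f :: "real \<Rightarrow> real"
  assumes [measurable]: "f \<in> borel_measurable borel"
    and "has_bochner_integral lborel (\<lambda>x. indicator {0<..} x * (f (1 / x) / x\<^sup>2)) b"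
  shows "has_bochner_integral lborel (\<lambda>x. indicator {0<..} x * f x) b"
proof -
  have image: "(\<lambda>x :: real. 1 / x) ` {0<..} = {0<..}"
  proof
    show "{0<..} \<subseteq> (\<lambda>x :: real. 1 / x) ` {0<..}"
      by (auto intro!: image_eqI[where x = "1 / _"])
  qed auto
  \<comment> \<open>The change of variables theorem speaks of \<open>lebesgue\<close>, the
    completion of \<open>lborel\<close>; for Borel functions integrability and integral agree on
    both.\<close>
  have iff: "(\<lambda>x. indicator {0<..} x * g x) \<in> borel_measurable borel \<Longrightarrow>
      has_bochner_integral lborel (\<lambda>x. indicator {0<..} x * g x) b \<longleftrightarrow>
      g absolutely_integrable_on {0<..} \<and> integral {0<..} g = b" for g :: "real \<Rightarrow> real"
    by (auto simp: has_bochner_integral_iff set_integrable_def integrable_completion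
      set_lebesgue_integral_eq_integral(2)[symmetric] set_lebesgue_integral_def integral_completion)
  have "(\<lambda>x. \<bar>- 1 / x\<^sup>2\<bar> * f (1 / x)) = (\<lambda>x. f (1 / x) / x\<^sup>2)"
    by auto
  with assms(2) have "(\<lambda>x. \<bar>- 1 / x\<^sup>2\<bar> * f (1 / x)) absolutely_integrable_on {0<..} \<and>
      integral {0<..} (\<lambda>x. \<bar>- 1 / x\<^sup>2\<bar> * f (1 / x)) = b"
    by (subst (asm) iff) auto
  also have "?this \<longleftrightarrow> f absolutely_integrable_on (\<lambda>x. 1 / x) ` {0<..} \<and>
      integral ((\<lambda>x. 1 / x) ` {0<..}) f = b"
    by (rule has_absolute_integral_change_of_variables_1')
      (auto intro!: derivative_eq_intros inj_onI simp: power2_eq_square)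
  finally show ?thesis
    unfolding image by (subst iff) auto
qed

section \<open>The density and the entropy integral\<close>

lemma iwl_density_measurable [measurable]: "iwl_density phi lam \<in> borel_measurable borel"
  unfolding iwl_density_def by measurable

lemma iwl_density_nonneg:
  assumes "phi > 0" "lam > 0"
  shows "iwl_density phi lam t \<ge> 0"
  using assms by (auto simp: iwl_density_def intro!: mult_nonneg_nonneg divide_nonneg_nonneg Gamma_real_nonneg)

text \<open>Since \<open>ln (x + 1) \<le> x\<close>, the integrand is dominated by a sum of Gamma
  kernels of shapes \<open>phi + 1\<close> and \<open>phi + 2\<close>.\<close>

lemma set_integrable_iwl_Omega:
  fixes phi lam :: real
  assumes "phi > 0" "lam > 0"
  shows "set_integrable lborel {0<..} (\<lambda>x. (x + 1) * ln (x + 1) * x powr (phi - 1) * exp (- lam * x))"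
proof -
  define k where "k = (\<lambda>b x :: real. x powr (b - 1) * exp (- lam * x))"
  have k: "set_integrable lborel {0<..} (k b)" if "b > 0" for b
    using has_bochner_integral_Gamma[OF that assms(2)]
    by (simp add: k_def set_integrable_def has_bochner_integral_iff)
  have "set_integrable lborel {0<..} (\<lambda>x. k (phi + 2) x + k (phi + 1) x)"
    using assms by (intro set_integral_add k) auto
  then show ?thesis
  proof (rule set_integrable_bound)
    show "set_borel_measurable lborel {0<..} (\<lambda>x. (x + 1) * ln (x + 1) * x powr (phi - 1) * exp (- lam * x))"
      unfolding set_borel_measurable_def by measurable
    show "AE x in lborel. x \<in> {0<..} \<longrightarrow>
      norm ((x + 1) * ln (x + 1) * x powr (phi - 1) * exp (- lam * x)) \<le> norm (k (phi + 2) x + k (phi + 1) x)"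
    proof (intro AE_I2 impI)
      fix x :: real assume "x \<in> {0<..}"
      then have x: "x > 0" by simp
      have "(x + 1) * ln (x + 1) * (x powr (phi - 1) * exp (- lam * x))
          \<le> (x + 1) * x * (x powr (phi - 1) * exp (- lam * x))"
        using x ln_le_minus_one[of "x + 1"] by (intro mult_right_mono mult_left_mono) auto
      also have "\<dots> = k (phi + 2) x + k (phi + 1) x"
        using x by (simp add: k_def powr_add powr_diff field_simps power2_eq_square)
      finally show "norm ((x + 1) * ln (x + 1) * x powr (phi - 1) * exp (- lam * x))
          \<le> norm (k (phi + 2) x + k (phi + 1) x)"
        using x by (simp add: k_def mult.assoc)
    qed
  qed
qed

text \<open>After inversion the logarithm of the density is a sum of four terms, each with a known
  integral against the Gamma kernels. The value is the negated entropy, as the integrand carries no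
  sign.\<close>

lemma has_bochner_integral_iwl_ln:
  fixes phi lam :: real
  assumes "phi > 0" "lam > 0"
  shows "has_bochner_integral lborel
    (\<lambda>t. indicator {0<..} t * (ln (iwl_density phi lam t) * iwl_density phi lam t))
    (- (ln (lam + phi) + ln (Gamma phi) + phi * (lam + phi + 1) / (lam + phi)
        - (phi + 1) * (1 / (lam + phi) + Digamma phi)
        - lam powr (phi + 1) * iwl_Omega phi lam / ((lam + phi) * Gamma phi)))"
    (is "has_bochner_integral _ _ ?H")
proof (rule has_bochner_integral_inversion)
  define C where "C = lam powr (phi + 1) / ((phi + lam) * Gamma phi)"
  define k where "k = (\<lambda>b x :: real. indicator {0<..} x * (x powr (b - 1) * exp (- lam * x)))"
  define l where "l = (\<lambda>b x :: real. indicator {0<..} x * (ln x * (x powr (b - 1) * exp (- lam * x))))"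
  define om where "om = (\<lambda>x :: real. indicator {0<..} x * ((x + 1) * ln (x + 1) * x powr (phi - 1) * exp (- lam * x)))"
  define G where "G = (\<lambda>b :: real. Gamma b / lam powr b)"
  define L where "L = (\<lambda>b :: real. G b * (Digamma b - ln lam))"
  have Gamma_pos: "Gamma phi > 0" using assms by (simp add: Gamma_real_pos)
  then have Gamma_ne: "Gamma phi \<noteq> 0" by linarith
  have C_pos: "C > 0" using assms Gamma_pos by (simp add: C_def)
  have k: "has_bochner_integral lborel (k b) (G b)" if "b > 0" for b
    unfolding k_def G_def using has_bochner_integral_Gamma[OF that assms(2)] .
  have l: "has_bochner_integral lborel (l b) (L b)" if "b > 0" for b
    unfolding l_def L_def G_def using has_bochner_integral_Gamma_ln[OF that assms(2)] .
  have om: "has_bochner_integral lborel om (iwl_Omega phi lam)"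
    using set_integrable_iwl_Omega[OF assms]
    by (simp add: om_def iwl_Omega_def set_integrable_def set_lebesgue_integral_def has_bochner_integral_iff)
  \<comment> \<open>The factor \<open>1 + x\<close> of the density pairs each shape with its
    successor; the term \<open>lam * x\<close> of the logarithm raises both shapes by one
    more.\<close>
  have "has_bochner_integral lborel
     (\<lambda>x. C * (ln C * (k phi x + k (phi + 1) x) + (phi + 1) * (l phi x + l (phi + 1) x) + om x
        - lam * (k (phi + 1) x + k (phi + 2) x)))
     (C * (ln C * (G phi + G (phi + 1)) + (phi + 1) * (L phi + L (phi + 1)) + iwl_Omega phi lam
        - lam * (G (phi + 1) + G (phi + 2))))"
    using assms by (intro has_bochner_integral_mult_right has_bochner_integral_add
        has_bochner_integral_diff k l om) auto
  also have "(\<lambda>x. C * (ln C * (k phi x + k (phi + 1) x) + (phi + 1) * (l phi x + l (phi + 1) x) + om x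
        - lam * (k (phi + 1) x + k (phi + 2) x)))
     = (\<lambda>x. indicator {0<..} x * (ln (iwl_density phi lam (1 / x)) * iwl_density phi lam (1 / x) / x\<^sup>2))"
  proof
    fix x :: real
    show "C * (ln C * (k phi x + k (phi + 1) x) + (phi + 1) * (l phi x + l (phi + 1) x) + om x
        - lam * (k (phi + 1) x + k (phi + 2) x))
      = indicator {0<..} x * (ln (iwl_density phi lam (1 / x)) * iwl_density phi lam (1 / x) / x\<^sup>2)"
    proof (cases "x > 0")
      case True
      have dens: "iwl_density phi lam (1 / x) = C * x powr (phi + 1) * (1 + x) * exp (- lam * x)"
        using True by (simp add: iwl_density_def C_def powr_divide powr_minus_divide powr_diff powr_add field_simps)
      have ln: "ln (iwl_density phi lam (1 / x)) = ln C + (phi + 1) * ln x + ln (x + 1) - lam * x"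
        unfolding dens using True C_pos by (simp add: ln_mult ln_powr add.commute)
      \<comment> \<open>With all powers expressed through \<open>P\<close>, the comparison of
        integrands becomes pure ring algebra.\<close>
      define P where "P = x powr (phi - 1)"
      have P: "x powr phi = x * P" "x powr (phi + 1) = x\<^sup>2 * P" "x powr (1 + phi) = x\<^sup>2 * P"
        using True by (auto simp: P_def powr_diff powr_add power2_eq_square)
      have *: "iwl_density phi lam (1 / x) / x\<^sup>2 = C * P * (1 + x) * exp (- lam * x)"
        using True unfolding dens P by simp
      have "indicator {0<..} x * (ln (iwl_density phi lam (1 / x)) * iwl_density phi lam (1 / x) / x\<^sup>2)
          = (ln C + (phi + 1) * ln x + ln (x + 1) - lam * x) * (C * P * (1 + x) * exp (- lam * x))"
        unfolding ln *[symmetric] using True by simp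
      also have "\<dots> = C * (ln C * (k phi x + k (phi + 1) x) + (phi + 1) * (l phi x + l (phi + 1) x) + om x
        - lam * (k (phi + 1) x + k (phi + 2) x))"
        using True by (simp add: k_def l_def om_def P P_def[symmetric]) (simp add: algebra_simps power2_eq_square P)
      finally show ?thesis ..
    qed (auto simp: k_def l_def om_def)
  qed
  also have "C * (ln C * (G phi + G (phi + 1)) + (phi + 1) * (L phi + L (phi + 1)) + iwl_Omega phi lam
        - lam * (G (phi + 1) + G (phi + 2))) = ?H"
  proof -
    have Gamma1: "Gamma (phi + 1) = phi * Gamma phi"
      using assms by (intro Gamma_plus1) (auto elim!: nonpos_Ints_cases)
    have Gamma2: "Gamma (phi + 2) = (phi + 1) * (phi * Gamma phi)"
    proof -
      have "phi + 1 \<notin> \<int>\<^sub>\<le>\<^sub>0" using assms by (auto dest: nonpos_Ints_nonpos)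
      from Gamma_plus1[OF this] show ?thesis by (simp add: Gamma1 add.assoc)
    qed
    \<comment> \<open>The first two values are the mixture weights of the Gamma densities of shapes
      \<open>phi\<close> and \<open>phi + 1\<close>.\<close>
    have CG: "C * G phi = lam / (lam + phi)" "C * G (phi + 1) = phi / (lam + phi)"
      "lam * (C * G (phi + 2)) = phi * (phi + 1) / (lam + phi)"
    proof -
      have "lam + phi \<noteq> 0" "phi + lam \<noteq> 0" using assms by auto
      then show "C * G phi = lam / (lam + phi)" "C * G (phi + 1) = phi / (lam + phi)"
        "lam * (C * G (phi + 2)) = phi * (phi + 1) / (lam + phi)"
        using assms Gamma_ne unfolding C_def G_def Gamma1 Gamma2
        by (simp_all add: powr_add power2_eq_square divide_simps)
    qed
    have sum1: "C * G phi + C * G (phi + 1) = 1"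
      unfolding CG using assms by (simp add: add_divide_distrib[symmetric])
    have lnC: "ln C = (phi + 1) * ln lam - ln (lam + phi) - ln (Gamma phi)"
      unfolding C_def using assms Gamma_ne by (simp add: ln_div ln_mult ln_powr add.commute)
    \<comment> \<open>This is the mean of \<open>ln x\<close> under the mixture. As
      \<open>Digamma (phi + 1) = Digamma phi + 1 / phi\<close>, the second weight contributes the
      extra \<open>1 / (lam + phi)\<close>.\<close>
    have L_sum: "C * L phi + C * L (phi + 1) = Digamma phi - ln lam + 1 / (lam + phi)"
    proof -
      have "C * L phi + C * L (phi + 1)
          = (C * G phi + C * G (phi + 1)) * (Digamma phi - ln lam) + C * G (phi + 1) / phi"
        unfolding L_def Digamma_plus1[OF less_imp_neq[OF assms(1), symmetric]]
        using assms by (simp add: field_simps)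
      then show ?thesis unfolding sum1 unfolding CG using assms by simp
    qed
    have "C * (ln C * (G phi + G (phi + 1)) + (phi + 1) * (L phi + L (phi + 1)) + iwl_Omega phi lam
        - lam * (G (phi + 1) + G (phi + 2)))
      = ln C * (C * G phi + C * G (phi + 1)) + (phi + 1) * (C * L phi + C * L (phi + 1))
        + C * iwl_Omega phi lam - (lam * (C * G (phi + 1)) + lam * (C * G (phi + 2)))"
      by (simp add: algebra_simps)
    also have "\<dots> = (phi + 1) * ln lam - ln (lam + phi) - ln (Gamma phi)
        + (phi + 1) * (Digamma phi - ln lam + 1 / (lam + phi))
        + C * iwl_Omega phi lam - phi * (lam + phi + 1) / (lam + phi)"
      unfolding sum1 L_sum lnC unfolding CG by (simp add: add_divide_distrib[symmetric] algebra_simps)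
    \<comment> \<open>The terms \<open>(phi + 1) * ln lam\<close> from \<open>ln C\<close> and from
      the mean of \<open>ln x\<close> cancel.\<close>
    also have "\<dots> = ?H"
      by (simp add: C_def algebra_simps)
    finally show ?thesis .
  qed
  finally show "has_bochner_integral lborel
    (\<lambda>x. indicator {0<..} x * (ln (iwl_density phi lam (1 / x)) * iwl_density phi lam (1 / x) / x\<^sup>2)) ?H" .
qed measurable

theorem proposition3p7:
  fixes M :: "'a measure" and T :: "'a \<Rightarrow> real" and phi lam :: real
  assumes "phi > 0" and "lam > 0"
    and "prob_space M"
    and "distributed M lborel T (\<lambda>t. ennreal (iwl_density phi lam t))"
  shows "set_integrable lborel {0<..} (\<lambda>t. ln (iwl_density phi lam t) * iwl_density phi lam t) \<and>
         set_integrable lborel {0<..}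
           (\<lambda>x. (x + 1) * ln (x + 1) * x powr (phi - 1) * exp (- lam * x)) \<and>
         prob_space.entropy M (exp 1) lborel T = iwl_entropy phi lam \<and>
         iwl_entropy phi lam =
           ln (lam + phi) + ln (Gamma phi) + phi * (lam + phi + 1) / (lam + phi)
           - (phi + 1) * (1 / (lam + phi) + Digamma phi)
           - lam powr (phi + 1) * iwl_Omega phi lam / ((lam + phi) * Gamma phi)"
proof -
  note H = has_bochner_integral_iwl_ln[OF assms(1,2)]
  interpret information_space M "exp 1"
    using assms(3) by (intro information_space.intro) (auto simp: information_space_axioms_def)
  have "entropy (exp 1) lborel T
      = - (\<integral>t. iwl_density phi lam t * log (exp 1) (iwl_density phi lam t) \<partial>lborel)"
    using assms by (intro entropy_distr iwl_density_nonneg)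
  \<comment> \<open>Base \<open>exp 1\<close> makes \<open>log\<close> the natural logarithm, and
    the density is 0 off \<open>{0<..}\<close>, so restricting the domain does not change the
    integral.\<close>
  also have "\<dots> = iwl_entropy phi lam"
    unfolding iwl_entropy_def set_lebesgue_integral_def
    by (intro arg_cong[where f = uminus] Bochner_Integration.integral_cong)
      (auto simp: log_def iwl_density_def)
  finally show ?thesis
    using H set_integrable_iwl_Omega[OF assms(1,2)]
    by (simp add: has_bochner_integral_iff set_integrable_def iwl_entropy_def set_lebesgue_integral_def)
qed

end
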